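(* In the setting of the context, assume that the advection field $V^\phi=-\Lambda\nabla\phi$ satisfies: (i) $V^\phi\cdot n\le 0$ almost everywhere on $\Gamma^N$; (ii) there exists $\beta<\frac{2\lambda_\flat\alpha_\flat}{C_P^2}$ such that $\mathrm{div}\,V^\phi\geq-\beta$ almost everywhere in $\Omega$. Let $\kappa>0$ be the coercivity constant (only depending on $\Lambda,\beta,\Omega,d,\Gamma^D$ and $\theta_{\mathcal{D}}$) such that $a_{\mathcal{D}}(\underline v_{\mathcal{D}},\underline v_{\mathcal{D}})\ge\kappa|\underline v_{\mathcal{D}}|_{1,\mathcal{D}}^2$ for all $\underline v_{\mathcal{D}}\in\underline V_{\mathcal{D},0}$. Let $(\underline u^n_{\mathcal{D}}\in\underline V_{\mathcal{D},0})_{n\ge1}$ be the solution to the evolution scheme and $\underline u^\infty_{\mathcal{D}}\in\underline V_{\mathcal{D},0}$ the solution to the stationary scheme given in the context, and set $$\mathbb{E}^n=\tfrac12\|u^n_{\mathcal{M}}-u^\infty_{\mathcal{M}}\|^2_{L^2(\Omega)}\ (n\ge0),\qquad \mathbb{D}^n=a_{\mathcal{D}}(\underline u^n_{\mathcal{D}}-\underline u^\infty_{\mathcal{D}},\underline u^n_{\mathcal{D}}-\underline u^\infty_{\mathcal{D}})\ (n\ge1).$$ Then $$\forall n\in\mathbb{N},\qquad\frac{\mathbb{E}^{n+1}-\mathbb{E}^n}{\Delta t}+\mathbb{D}^{n+1}\le0.$$ Furthermore, with $\nu:=\frac{2\kappa}{C_P^2}>0$, $$\forall n\in\mathbb{N},\qquad\mathbb{E}^{n+1}\le(1+\nu\Delta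 t)^{-1}\mathbb{E}^n.$$ Consequently, for all $n\geq1$, $$\|u^n_{\mathcal{M}}-u^\infty_{\mathcal{M}}\|_{L^2(\Omega)}\le(1+\nu\Delta t)^{-\frac n2}\|u^0_{\mathcal{M}}-u^\infty_{\mathcal{M}}\|_{L^2(\Omega)}.$$
   Context: **Data.** $\Omega\subset\mathbb{R}^d$, $d\in\{2,3\}$, is open, bounded, connected and polytopal, $\partial\Omega=\overline{\Gamma^D}\cup\overline{\Gamma^N}$ with $\Gamma^D,\Gamma^N$ disjoint and open in $\partial\Omega$; $n$ is the unit outward normal. $\Lambda\in L^\infty(\Omega;\mathbb{R}^{d\times d})$ is symmetric with, for some $0<\lambda_\flat\le\lambda_\sharp<\infty$, $\xi\cdot\Lambda(x)\xi\ge\lambda_\flat|\xi|^2$ and $|\Lambda(x)\xi|\le\lambda_\sharp|\xi|$ for a.e. $x$ and all $\xi\in\mathbb{R}^d$. $\phi\in C^1(\overline\Omega)$ and $V^\phi:=-\Lambda\nabla\phi\in H(\mathrm{div};\Omega)$. $f\in L^2(\Omega)$, $g^N\in L^2(\Gamma^N)$, $u^{in}\in L^2(\Omega)$. When $|\Gamma^D|=0$ it is assumed that $\int_\Omega f+\int_{\partial\Omega}g^N=0$ and $\int_\Omega u^{in}=0$; when $|\Gamma^D|>0$ the Dirichlet datum is $0$. $\Delta t>0$ is fixed. **Discretisation.** A discretisation of $\Omega$ is a triplet $\mathcal{D}=(\mathcal{M},\mathcal{E},\mathcal{P})$. $\mathcal{M}$ is a finite family of nonempty disjoint open connected polytopal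 subsets $K$ of $\Omega$ (cells) with $|K|>0$ and $\overline\Omega=\bigcup_K\overline K$. $\mathcal{E}$ is a finite family of nonempty disjoint (relatively open) connected subsets $\sigma$ of $\overline\Omega$ (faces), each of positive $(d-1)$-dimensional measure $|\sigma|$ and contained in an affine hyperplane $\mathcal{H}_\sigma$, with $\bigcup_K\partial K=\bigcup_\sigma\overline\sigma$; for each $K$ there is $\mathcal{E}_K\subset\mathcal{E}$ with $\partial K=\bigcup_{\sigma\in\mathcal{E}_K}\overline\sigma$. With $\mathcal{M}_\sigma=\{K:\sigma\in\mathcal{E}_K\}$, each $\sigma$ is either a boundary face ($\mathcal{M}_\sigma=\{K\}$, $\sigma\subset\partial\Omega$) or an interface ($\mathcal{M}_\sigma=\{K,L\}$). Each boundary face is contained in $\Gamma^D$ or in $\Gamma^N$; $\mathcal{E}^D_{ext}$ is the set of those contained in $\Gamma^D$. $\mathcal{P}=\{x_K\}_{K\in\mathcal{M}}$ with $x_K\in K$, $K$ star-shaped with respect to $x_K$, and the distance $d_{K,\sigma}$ from $x_K$ to $\mathcal{H}_\sigma$ positive for all $\sigma\in\mathcal{E}_K$. $h_K$ is the diameter of $K$, $\overline{x}_\sigma$ the barycentre of $\sigma$, $n_{K,\sigma}$ the unit normal to $\sigma$ outward to $K$, $P_{K,\sigma}$ the open pyramid with base $\sigma$ and apex $x_K$, and $\theta_{\mathcal{D}}=\max\big(\max_{K,\sigma\in\mathcal{E}_K}\frac{h_K}{d_{K,\sigma}},\max_{\sigma,K\in\mathcal{M}_\sigma}\frac{h_K^{d-1}}{|\sigma|}\big)$.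 **Unknowns.** $\underline{V}_{\mathcal{D}}$ is the space of real vectors $\underline{v}_{\mathcal{D}}=((v_K)_{K\in\mathcal{M}},(v_\sigma)_{\sigma\in\mathcal{E}})$; $\underline{v}_K=(v_K,(v_\sigma)_{\sigma\in\mathcal{E}_K})$; $v_{\mathcal{M}}$ (resp. $v_{\mathcal{E}}$) is the piecewise constant function equal to $v_K$ on $K$ (resp. $v_\sigma$ on $\sigma$); $(\cdot,\cdot)_X$ is the $L^2(X)$ inner product. $\underline V_{\mathcal{D},0}$ denotes $\underline V^N_{\mathcal{D},0}=\{\underline v_{\mathcal{D}}:\int_\Omega v_{\mathcal{M}}=0\}$ if $|\Gamma^D|=0$ and $\underline V^D_{\mathcal{D},0}=\{\underline v_{\mathcal{D}}:v_\sigma=0\ \forall\sigma\in\mathcal{E}^D_{ext}\}$ if $|\Gamma^D|>0$. $|\underline v_{\mathcal{D}}|_{1,\mathcal{D}}^2=\sum_K\sum_{\sigma\in\mathcal{E}_K}\frac{|\sigma|}{d_{K,\sigma}}(v_K-v_\sigma)^2$. **Diffusive form.** With a fixed $\eta>0$, $\nabla_K\underline v_K$ equals on $P_{K,\sigma}$ the vector $G_K\underline v_K+\frac{\eta}{d_{K,\sigma}}\big(v_\sigma-v_K-G_K\underline v_K\cdot(\overline x_\sigma-x_K)\big)n_{K,\sigma}$, where $G_K\underline v_K=\frac1{|K|}\sum_{\sigma'\in\mathcal{E}_K}|\sigma'|(v_{\sigma'}-v_K)n_{K,\sigma'}$; $a^\Lambda_K(\underline u_K,\underline v_K)=\int_K\Lambda\nabla_K\underline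 u_K\cdot\nabla_K\underline v_K$, $a^\Lambda_{\mathcal{D}}=\sum_Ka^\Lambda_K$. **Advective form.** $A:\mathbb{R}\to\mathbb{R}$ is a fixed Lipschitz function with $A(0)=0$, $A(-s)-A(s)=s$ and $A(-s)+A(s)\ge0$ for all $s$. Let $V^\phi_{K,\sigma}=\frac1{|\sigma|}\int_\sigma V^\phi\cdot n_{K,\sigma}$, $\Lambda_K=\frac1{|K|}\int_K\Lambda$, $\mu_\sigma=\min(1,\min_{K\in\mathcal{M}_\sigma}\mathrm{Sp}(\Lambda_K))>0$ ($\mathrm{Sp}$ = spectrum), and $$F^\phi_{K,\sigma}(\underline u_K)=|\sigma|\frac{\mu_\sigma}{d_{K,\sigma}}\Big(A\big(-\tfrac{d_{K,\sigma}}{\mu_\sigma}V^\phi_{K,\sigma}\big)u_K-A\big(\tfrac{d_{K,\sigma}}{\mu_\sigma}V^\phi_{K,\sigma}\big)u_\sigma\Big),\quad a^\phi_K(\underline u_K,\underline v_K)=\sum_{\sigma\in\mathcal{E}_K}F^\phi_{K,\sigma}(\underline u_K)(v_K-v_\sigma).$$ Set $a_{\mathcal{D}}(\underline u_{\mathcal{D}},\underline v_{\mathcal{D}})=\sum_K\big(a_K^\Lambda(\underline u_K,\underline v_K)+a_K^\phi(\underline u_K,\underline v_K)\big)$. **Schemes.** Stationary: find $\underline u^\infty_{\mathcal{D}}\in\underline V_{\mathcal{D},0}$ with $a_{\mathcal{D}}(\underline u^\infty_{\mathcal{D}},\underline v_{\mathcal{D}})=(f,v_{\mathcal{M}})_\Omega+(g^N,v_{\mathcal{E}})_{\Gamma^N}$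 for all $\underline v_{\mathcal{D}}\in\underline V_{\mathcal{D},0}$. Evolution: find $\underline u^n_{\mathcal{D}}\in\underline V_{\mathcal{D},0}$, $n\ge1$, with $\frac1{\Delta t}(u^n_{\mathcal{M}}-u^{n-1}_{\mathcal{M}},v_{\mathcal{M}})_\Omega+a_{\mathcal{D}}(\underline u^n_{\mathcal{D}},\underline v_{\mathcal{D}})=(f,v_{\mathcal{M}})_\Omega+(g^N,v_{\mathcal{E}})_{\Gamma^N}$ for all $\underline v_{\mathcal{D}}\in\underline V_{\mathcal{D},0}$, and $u^0_K=\frac1{|K|}\int_Ku^{in}$. Under (i)–(ii) both are well-posed and a constant $\kappa$ as in the claim exists. **Constants.** $\alpha_\flat>0$ depends only on $\Omega,d,\theta_{\mathcal{D}}$ and is such that $\alpha_\flat\sum_{\sigma\in\mathcal{E}_K}\frac{|\sigma|}{d_{K,\sigma}}(v_K-v_\sigma)^2\le\|\nabla_K\underline v_K\|^2_{L^2(K;\mathbb{R}^d)}$ for all $K$, $\underline v_K$ (so $a^\Lambda_{\mathcal{D}}(\underline v_{\mathcal{D}},\underline v_{\mathcal{D}})\ge\lambda_\flat\alpha_\flat|\underline v_{\mathcal{D}}|^2_{1,\mathcal{D}}$). $C_P$ is the discrete Poincaré constant: $\|v_{\mathcal{M}}\|_{L^2(\Omega)}\le C_P|\underline v_{\mathcal{D}}|_{1,\mathcal{D}}$ for all $\underline v_{\mathcal{D}}\in\underline V_{\mathcal{D},0}$, with $C_P=C_{PW}$ depending only on $\Omega,d,\theta_{\mathcal{D}}$ if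 $|\Gamma^D|=0$, and $C_P=C_{P,\Gamma^D}$ depending only on $\Omega,d,\Gamma^D,\theta_{\mathcal{D}}$ otherwise. *)

theory Defs
  imports "HOL-Analysis.Analysis"
begin

section \<open>Surface measure\<close>

text \<open>The \<open>k\<close>-dimensional Hausdorff measure, normalised so that it agrees with Lebesgue
  measure on \<open>k\<close>-dimensional affine subspaces, on the sets that are measurable in the sense of
  Caratheodory; these include the Borel sets. The library's outer measure uses disjoint covers;
  as the cost is monotone, this gives the same value as arbitrary countable covers.\<close>

definition hausdorff_cost :: "nat \<Rightarrow> real \<Rightarrow> 'a::metric_space set \<Rightarrow> ennreal" where
  "hausdorff_cost k \<delta> U =
     (if U = {} then 0
      else if bounded U \<and> diameter U \<le> \<delta> then ennreal (unit_ball_vol (real k) * (diameter U / 2) ^ k)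
      else \<infinity>)"

definition hausdorff_pre :: "nat \<Rightarrow> real \<Rightarrow> 'a::metric_space set \<Rightarrow> ennreal" where
  "hausdorff_pre k \<delta> = outer_measure UNIV (hausdorff_cost k \<delta>)"

definition hausdorff_outer :: "nat \<Rightarrow> 'a::metric_space set \<Rightarrow> ennreal" where
  "hausdorff_outer k A = (SUP \<delta>\<in>{0<..}. hausdorff_pre k \<delta> A)"

definition hausdorff_measure :: "nat \<Rightarrow> 'a::metric_space measure" where
  "hausdorff_measure k =
     measure_of UNIV (lambda_system UNIV UNIV (hausdorff_outer k)) (hausdorff_outer k)"

lemma positive_hausdorff_cost: "positive UNIV (hausdorff_cost k \<delta>)"
  by (simp add: positive_def hausdorff_cost_def)

lemma increasing_hausdorff_cost: "increasing UNIV (hausdorff_cost k \<delta>)"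
  unfolding increasing_def
proof (intro ballI impI)
  fix U V :: "'a set"
  assume "U \<subseteq> V"
  show "hausdorff_cost k \<delta> U \<le> hausdorff_cost k \<delta> V"
  proof (cases "U \<noteq> {} \<and> bounded V \<and> diameter V \<le> \<delta>")
    case True
    then have "bounded U" "diameter U \<le> diameter V" "V \<noteq> {}"
      using \<open>U \<subseteq> V\<close> by (auto intro: bounded_subset diameter_subset)
    moreover have "(diameter U / 2) ^ k \<le> (diameter V / 2) ^ k"
      using calculation diameter_ge_0[of U] by (intro power_mono) auto
    ultimately show ?thesis
      using True
      by (auto simp: hausdorff_cost_def intro!: ennreal_leI mult_left_mono)
  qed (use \<open>U \<subseteq> V\<close> in \<open>auto simp: hausdorff_cost_def\<close>)
qed

lemma outer_measure_space_hausdorff_pre: "outer_measure_space UNIV (hausdorff_pre k \<delta>)"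
proof -
  interpret algebra UNIV "UNIV :: 'a set set"
    using algebra_Pow[of "UNIV :: 'a set"] by simp
  show ?thesis
    using outer_measure_space_outer_measure[OF positive_hausdorff_cost increasing_hausdorff_cost]
    by (simp add: hausdorff_pre_def)
qed

lemma outer_measure_space_hausdorff_outer:
  "outer_measure_space UNIV (hausdorff_outer k :: 'a::metric_space set \<Rightarrow> ennreal)"
  unfolding outer_measure_space_def
proof (intro conjI)
  have oms: "positive UNIV (hausdorff_pre k \<delta> :: 'a set \<Rightarrow> ennreal)"
    "increasing UNIV (hausdorff_pre k \<delta> :: 'a set \<Rightarrow> ennreal)"
    "countably_subadditive UNIV (hausdorff_pre k \<delta> :: 'a set \<Rightarrow> ennreal)" for \<delta>
    using outer_measure_space_hausdorff_pre[of k \<delta>] by (auto simp: outer_measure_space_def)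
  show "positive UNIV (hausdorff_outer k :: 'a set \<Rightarrow> ennreal)"
    using oms(1) by (auto simp: positive_def hausdorff_outer_def)
  show "increasing UNIV (hausdorff_outer k :: 'a set \<Rightarrow> ennreal)"
    unfolding increasing_def hausdorff_outer_def
    by (intro ballI impI SUP_mono) (meson increasingD oms(2) UNIV_I)
  show "countably_subadditive UNIV (hausdorff_outer k :: 'a set \<Rightarrow> ennreal)"
    unfolding countably_subadditive_def
  proof (intro allI impI)
    fix A :: "nat \<Rightarrow> 'a set"
    assume "range A \<subseteq> UNIV" "disjoint_family A" "\<Union> (range A) \<in> UNIV"
    then have "hausdorff_pre k \<delta> (\<Union> (range A)) \<le> (\<Sum>i. hausdorff_pre k \<delta> (A i))" for \<delta>
      using oms(3) by (auto simp: countably_subadditive_def)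
    also have "(\<Sum>i. hausdorff_pre k \<delta> (A i)) \<le> (\<Sum>i. hausdorff_outer k (A i))" if "\<delta> > 0" for \<delta>
      using that by (intro suminf_le) (auto simp: hausdorff_outer_def intro: SUP_upper)
    finally show "hausdorff_outer k (\<Union> (range A)) \<le> (\<Sum>i. hausdorff_outer k (A i))"
      by (subst hausdorff_outer_def) (auto intro!: SUP_least)
  qed
qed

lemma sets_hausdorff_measure:
    "sets (hausdorff_measure k :: 'a::metric_space measure)
       = lambda_system UNIV UNIV (hausdorff_outer k)"
  and emeasure_hausdorff_measure:
    "A \<in> sets (hausdorff_measure k :: 'a measure) \<Longrightarrow>
       emeasure (hausdorff_measure k) A = hausdorff_outer k A"
  and space_hausdorff_measure: "space (hausdorff_measure k :: 'a measure) = UNIV"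
proof -
  let ?L = "lambda_system UNIV UNIV (hausdorff_outer k) :: 'a set set"
  interpret sigma_algebra UNIV "UNIV :: 'a set set"
    using sigma_algebra_Pow[of "UNIV :: 'a set"] by simp
  have ms: "measure_space UNIV ?L (hausdorff_outer k)"
    by (rule caratheodory_lemma[OF outer_measure_space_hausdorff_outer])
  then have sa: "sigma_algebra UNIV ?L"
    by (simp add: measure_space_def)
  show *: "sets (hausdorff_measure k :: 'a measure) = ?L"
    using sigma_algebra.sigma_sets_eq[OF sa] by (simp add: hausdorff_measure_def)
  show "space (hausdorff_measure k :: 'a measure) = UNIV"
    by (simp add: hausdorff_measure_def)
  show "A \<in> sets (hausdorff_measure k :: 'a measure) \<Longrightarrow>
      emeasure (hausdorff_measure k) A = hausdorff_outer k A"
    unfolding * unfolding hausdorff_measure_def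
    using ms by (intro emeasure_measure_of_sigma) (auto simp: measure_space_def)
qed

lemma hausdorff_outer_mono: "S \<subseteq> T \<Longrightarrow> hausdorff_outer k S \<le> hausdorff_outer k T"
  using outer_measure_space_hausdorff_outer[of k]
  by (auto simp: outer_measure_space_def increasing_def)

lemma hausdorff_outer_empty: "hausdorff_outer k {} = 0"
  using outer_measure_space_hausdorff_outer[of k]
  by (auto simp: outer_measure_space_def positive_def)

lemma hausdorff_outer_UN_le:
  "hausdorff_outer k (\<Union>i::nat. A i) \<le> (\<Sum>i. hausdorff_outer k (A i))"
proof -
  have "hausdorff_outer k (\<Union>i. disjointed A i) \<le> (\<Sum>i. hausdorff_outer k (disjointed A i))"
    using outer_measure_space_hausdorff_outer[of k] disjoint_family_disjointed[of A]
    unfolding outer_measure_space_def countably_subadditive_def by blast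
  also have "\<dots> \<le> (\<Sum>i. hausdorff_outer k (A i))"
    by (intro suminf_le hausdorff_outer_mono disjointed_subset) auto
  finally show ?thesis
    by (simp add: UN_disjointed_eq)
qed

lemma hausdorff_outer_Un_le:
  "hausdorff_outer k (S \<union> T) \<le> hausdorff_outer k S + hausdorff_outer k T"
proof -
  have "(\<Union>i::nat. if i = 0 then S else if i = 1 then T else {}) = S \<union> T"
    by (auto split: if_splits)
  then have "hausdorff_outer k (S \<union> T)
      \<le> (\<Sum>i::nat. hausdorff_outer k (if i = 0 then S else if i = 1 then T else {}))"
    using hausdorff_outer_UN_le[of k "\<lambda>i. if i = 0 then S else if i = 1 then T else {}"] by simp
  also have "\<dots> = (\<Sum>i\<in>{0, 1::nat}. hausdorff_outer k (if i = 0 then S else if i = 1 then T else {}))"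
    by (rule suminf_finite) (auto simp: hausdorff_outer_empty split: if_splits)
  finally show ?thesis
    by simp
qed

lemma hausdorff_outer_separated:
  fixes S T :: "'a::metric_space set"
  assumes "e > 0" and sep: "\<And>x y. x \<in> S \<Longrightarrow> y \<in> T \<Longrightarrow> e \<le> dist x y"
  shows "hausdorff_outer k S + hausdorff_outer k T \<le> hausdorff_outer k (S \<union> T)"
proof -
  interpret algebra UNIV "UNIV :: 'a set set"
    using algebra_Pow[of "UNIV :: 'a set"] by simp
  have pre: "hausdorff_pre k \<delta> S + hausdorff_pre k \<delta> T \<le> hausdorff_pre k \<delta> (S \<union> T)"
    if "\<delta> < e" for \<delta>
  proof -
    let ?f = "hausdorff_cost k \<delta> :: 'a set \<Rightarrow> ennreal"
    have "hausdorff_pre k \<delta> S + hausdorff_pre k \<delta> T \<le> (\<Sum>i. ?f (B i))"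
      if B: "S \<union> T \<subseteq> (\<Union>i. B i)" for B :: "nat \<Rightarrow> 'a set"
    proof -
      define B1 where "B1 i = (if B i \<inter> S = {} then {} else B i)" for i
      define B2 where "B2 i = (if B i \<inter> T = {} then {} else B i)" for i
      have "hausdorff_pre k \<delta> S \<le> (\<Sum>i. ?f (B1 i))"
        unfolding hausdorff_pre_def using B
        by (intro outer_measure_le positive_hausdorff_cost increasing_hausdorff_cost)
          (auto simp: B1_def, metis Int_iff UN_iff Un_iff empty_iff subsetD)
      moreover have "hausdorff_pre k \<delta> T \<le> (\<Sum>i. ?f (B2 i))"
        unfolding hausdorff_pre_def using B
        by (intro outer_measure_le positive_hausdorff_cost increasing_hausdorff_cost)
          (auto simp: B2_def, metis Int_iff UN_iff Un_iff empty_iff subsetD)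
      ultimately have "hausdorff_pre k \<delta> S + hausdorff_pre k \<delta> T
          \<le> (\<Sum>i. ?f (B1 i)) + (\<Sum>i. ?f (B2 i))"
        by (rule add_mono)
      also have "\<dots> = (\<Sum>i. ?f (B1 i) + ?f (B2 i))"
        by (rule suminf_add) auto
      also have "\<dots> \<le> (\<Sum>i. ?f (B i))"
      proof (rule suminf_le)
        fix i
        have "\<not> (bounded (B i) \<and> diameter (B i) \<le> \<delta>)" if "x \<in> B i \<inter> S" "y \<in> B i \<inter> T" for x y
          using that sep[of x y] diameter_bounded_bound[of "B i" x y] \<open>\<delta> < e\<close> by auto
        then have inf: "?f (B i) = \<infinity>" if "B i \<inter> S \<noteq> {}" "B i \<inter> T \<noteq> {}"
          using that by (auto simp: hausdorff_cost_def)
        have [simp]: "?f {} = 0"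
          by (simp add: hausdorff_cost_def)
        show "?f (B1 i) + ?f (B2 i) \<le> ?f (B i)"
          unfolding B1_def B2_def using inf
          by (cases "B i \<inter> S = {}"; cases "B i \<inter> T = {}") simp_all
      qed auto
      finally show ?thesis .
    qed
    then show ?thesis
      unfolding hausdorff_pre_def[of k \<delta>] outer_measure_def[of UNIV _ "S \<union> T"]
      by (intro INF_greatest) (auto simp: hausdorff_pre_def)
  qed
  have anti: "hausdorff_pre k \<delta>' X \<le> hausdorff_pre k \<delta> X" if "\<delta> \<le> \<delta>'" for \<delta> \<delta>' and X :: "'a set"
    unfolding hausdorff_pre_def outer_measure_def
    using that by (intro INF_mono bexI suminf_le) (auto simp: hausdorff_cost_def)
  have "hausdorff_pre k \<delta> S + hausdorff_pre k \<delta>' T \<le> hausdorff_outer k (S \<union> T)"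
    if "\<delta> > 0" "\<delta>' > 0" for \<delta> \<delta>'
  proof -
    define m where "m = min (min \<delta> \<delta>') (e / 2)"
    have m: "m > 0" "m \<le> \<delta>" "m \<le> \<delta>'" "m < e"
      using that \<open>e > 0\<close> by (auto simp: m_def)
    have "hausdorff_pre k \<delta> S + hausdorff_pre k \<delta>' T \<le> hausdorff_pre k m S + hausdorff_pre k m T"
      using m by (intro add_mono anti)
    also have "\<dots> \<le> hausdorff_pre k m (S \<union> T)"
      using m by (intro pre)
    also have "\<dots> \<le> hausdorff_outer k (S \<union> T)"
      using m by (auto simp: hausdorff_outer_def intro: SUP_upper)
    finally show ?thesis .
  qed
  then have "(SUP \<delta>'\<in>{0<..}. SUP \<delta>\<in>{0<..}. hausdorff_pre k \<delta> S + hausdorff_pre k \<delta>' T)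
      \<le> hausdorff_outer k (S \<union> T)"
    by (intro SUP_least) auto
  moreover have "{0<..} \<noteq> ({} :: real set)"
    by simp
  ultimately show ?thesis
    by (simp only: hausdorff_outer_def[of k S] hausdorff_outer_def[of k T]
        ennreal_SUP_add_left ennreal_SUP_add_right not_False_eq_True)
qed

lemma hausdorff_caratheodory_closed:
  fixes A C :: "'a::metric_space set"
  assumes "closed C" "C \<noteq> {}"
  shows "hausdorff_outer k (A \<inter> C) + hausdorff_outer k (A - C) \<le> hausdorff_outer k A"
proof (cases "hausdorff_outer k A = top")
  case fin: False
  let ?H = "hausdorff_outer k :: 'a set \<Rightarrow> ennreal"
  define a where "a n = {x \<in> A. 1 / Suc n \<le> infdist x C}" for n :: nat
  define r where "r n = a (Suc n) - a n" for n
  have mono: "a m \<subseteq> a n" if "m \<le> n" for m n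
  proof
    fix x assume "x \<in> a m"
    moreover have "1 / real (Suc n) \<le> 1 / real (Suc m)"
      using that by (intro divide_left_mono) auto
    ultimately show "x \<in> a n" by (auto simp: a_def)
  qed
  have inf: "infdist x C \<le> dist x y + infdist y C" for x y
    using infdist_triangle[of x C y] by (simp add: add.commute)
  have UNa: "A - C = (\<Union>n. a n)"
  proof -
    have "x \<in> (\<Union>n. a n)" if "x \<in> A - C" for x
    proof -
      have "infdist x C > 0"
        using that assms by (simp add: infdist_pos_not_in_closed)
      then obtain n where "1 / real (Suc n) < infdist x C"
        by (metis nat_approx_posE)
      with that have "x \<in> a n"
        by (auto simp: a_def)
      then show ?thesis by blast
    qed
    moreover have "x \<notin> C" if "x \<in> a n" for x n
    proof
      assume "x \<in> C"
      then have "infdist x C = 0" by simp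
      moreover have "1 / real (Suc n) > 0" by simp
      ultimately show False using that unfolding a_def by force
    qed
    moreover have "a n \<subseteq> A" for n by (auto simp: a_def)
    ultimately show ?thesis by blast
  qed
  have sep_r: "?H X + ?H (r (Suc n)) \<le> ?H (X \<union> r (Suc n))" if X: "X \<subseteq> a n" for X n
  proof (rule hausdorff_outer_separated)
    have "1 / real (Suc (Suc n)) < 1 / real (Suc n)"
      by (intro divide_strict_left_mono) auto
    then show "0 < 1 / real (Suc n) - 1 / real (Suc (Suc n))"
      by simp
    fix x y assume "x \<in> X" "y \<in> r (Suc n)"
    then have "1 / real (Suc n) \<le> infdist x C" "infdist y C < 1 / real (Suc (Suc n))"
      using X by (auto simp: a_def r_def)
    then show "1 / real (Suc n) - 1 / real (Suc (Suc n)) \<le> dist x y"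
      using inf[of x y] by linarith
  qed
  have sums: "(\<Sum>i<N. ?H (r (2 * i + j))) \<le> ?H (\<Union>i<N. r (2 * i + j))" for N j
  proof (induction N)
    case 0 then show ?case by simp
  next
    case (Suc N)
    show ?case
    proof (cases N)
      case 0
      then show ?thesis by (simp add: lessThan_Suc)
    next
      case (Suc M)
      define n where "n = 2 * M + j + 1"
      have n: "2 * N + j = Suc n" using Suc by (simp add: n_def)
      have sub: "(\<Union>i<N. r (2 * i + j)) \<subseteq> a n"
      proof (rule UN_least)
        fix i assume "i \<in> {..<N}"
        then have "Suc (2 * i + j) \<le> n"
          using Suc by (auto simp: n_def)
        then show "r (2 * i + j) \<subseteq> a n"
          using mono[of "Suc (2 * i + j)" n] by (auto simp: r_def)
      qed
      have "(\<Sum>i<Suc N. ?H (r (2 * i + j))) \<le> ?H (\<Union>i<N. r (2 * i + j)) + ?H (r (Suc n))"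
        using Suc.IH by (simp add: n add_mono)
      also have "\<dots> \<le> ?H ((\<Union>i<N. r (2 * i + j)) \<union> r (Suc n))"
        by (rule sep_r[OF sub])
      also have "(\<Union>i<N. r (2 * i + j)) \<union> r (Suc n) = (\<Union>i<Suc N. r (2 * i + j))"
        by (simp add: lessThan_Suc n Un_commute)
      finally show ?thesis .
    qed
  qed
  have "(\<Sum>i. ?H (r (2 * i + j))) \<le> ?H A" for j
  proof (rule suminf_le_const)
    fix N
    have "(\<Union>i<N. r (2 * i + j)) \<subseteq> A" by (auto simp: r_def a_def)
    then show "(\<Sum>i<N. ?H (r (2 * i + j))) \<le> ?H A"
      using sums[of j N] hausdorff_outer_mono order_trans by blast
  qed auto
  then have fin_r: "(\<Sum>i. ?H (r (2 * i + j))) < top" for j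
    using fin by (metis less_top order_le_less_trans)
  have bound: "?H (A \<inter> C) + ?H (A - C) \<le> ?H A +
      ((\<Sum>i. ?H (r (2 * (i + n) + 0))) + (\<Sum>i. ?H (r (2 * (i + n) + 1))))" for n
  proof -
    have "A - C \<subseteq> a (2 * n) \<union> ((\<Union>i. r (2 * (i + n) + 0)) \<union> (\<Union>i. r (2 * (i + n) + 1)))"
    proof
      fix x assume "x \<in> A - C"
      then have ex: "\<exists>m. x \<in> a m" using UNa by auto
      define m where "m = (LEAST m. x \<in> a m)"
      have xm: "x \<in> a m" unfolding m_def using ex by (metis LeastI_ex)
      show "x \<in> a (2 * n) \<union> ((\<Union>i. r (2 * (i + n) + 0)) \<union> (\<Union>i. r (2 * (i + n) + 1)))"
      proof (cases "m \<le> 2 * n")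
        case True then show ?thesis using mono[OF True] xm by auto
      next
        case False
        then obtain p where p: "m = Suc p" "p \<ge> 2 * n" by (cases m) auto
        then have xr: "x \<in> r p"
          using xm not_less_Least[of p "\<lambda>m. x \<in> a m"] by (auto simp: r_def m_def)
        have "\<exists>i. p = 2 * (i + n) + 0 \<or> p = 2 * (i + n) + 1"
          using p(2) by presburger
        with xr show ?thesis by blast
      qed
    qed
    then have "?H (A - C) \<le>
        ?H (a (2 * n) \<union> ((\<Union>i. r (2 * (i + n) + 0)) \<union> (\<Union>i. r (2 * (i + n) + 1))))"
      by (rule hausdorff_outer_mono)
    also have "\<dots> \<le> ?H (a (2 * n)) +
        (?H (\<Union>i. r (2 * (i + n) + 0)) + ?H (\<Union>i. r (2 * (i + n) + 1)))"
      by (meson add_left_mono hausdorff_outer_Un_le order_trans)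
    also have "\<dots> \<le> ?H (a (2 * n)) +
        ((\<Sum>i. ?H (r (2 * (i + n) + 0))) + (\<Sum>i. ?H (r (2 * (i + n) + 1))))"
      by (intro add_left_mono add_mono hausdorff_outer_UN_le)
    finally have "?H (A \<inter> C) + ?H (A - C) \<le> (?H (A \<inter> C) + ?H (a (2 * n))) +
        ((\<Sum>i. ?H (r (2 * (i + n) + 0))) + (\<Sum>i. ?H (r (2 * (i + n) + 1))))"
      by (simp add: add.assoc add_left_mono)
    moreover have "?H (A \<inter> C) + ?H (a (2 * n)) \<le> ?H (A \<inter> C \<union> a (2 * n))"
    proof (rule hausdorff_outer_separated)
      show "0 < 1 / real (Suc (2 * n))" by simp
      fix x y assume "x \<in> A \<inter> C" "y \<in> a (2 * n)"
      then show "1 / real (Suc (2 * n)) \<le> dist x y"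
        using inf[of y x] by (auto simp: a_def dist_commute)
    qed
    moreover have "?H (A \<inter> C \<union> a (2 * n)) \<le> ?H A"
      by (rule hausdorff_outer_mono) (auto simp: a_def)
    ultimately show ?thesis
      by (meson add_right_mono order_trans)
  qed
  have tail: "(\<lambda>n. \<Sum>i. ?H (r (2 * (i + n) + j))) \<longlonglongrightarrow> 0" for j
  proof -
    obtain q where q: "\<And>i. ?H (r (2 * i + j)) = ennreal (q i)" "\<And>i. q i \<ge> 0"
    proof -
      have "?H (r (2 * i + j)) < top" for i
        using fin_r[of j] by (rule ennreal_suminf_lessD)
      then show ?thesis
        using that[of "\<lambda>i. enn2real (?H (r (2 * i + j)))"] by simp
    qed
    have sq: "summable q"
      using fin_r[of j] q by (intro summable_suminf_not_top) auto
    have "(\<lambda>n. ennreal (\<Sum>i. q (i + n))) \<longlonglongrightarrow> ennreal 0"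
      by (intro tendsto_ennrealI suminf_exist_split2 sq)
    moreover have "(\<Sum>i. ?H (r (2 * (i + n) + j))) = ennreal (\<Sum>i. q (i + n))" for n
      unfolding q(1) using q(2) sq by (intro suminf_ennreal2) (auto simp: summable_iff_shift)
    ultimately show ?thesis by simp
  qed
  have "(\<lambda>n. ?H A + ((\<Sum>i. ?H (r (2 * (i + n) + 0))) + (\<Sum>i. ?H (r (2 * (i + n) + 1)))))
      \<longlonglongrightarrow> ?H A + (0 + 0)"
    by (intro tendsto_add tendsto_const tail)
  then show ?thesis
    using LIMSEQ_le_const[of _ "?H A" "?H (A \<inter> C) + ?H (A - C)"] bound by auto
qed simp

lemma borel_subset_sets_hausdorff_measure:
  "sets borel \<subseteq> sets (hausdorff_measure k :: 'a::metric_space measure)"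
proof -
  have "C \<in> sets (hausdorff_measure k)" if "closed C" for C :: "'a set"
  proof (cases "C = {}")
    case False
    have "hausdorff_outer k (C \<inter> A) + hausdorff_outer k ((UNIV - C) \<inter> A) = hausdorff_outer k A" for A
    proof (rule antisym)
      have [simp]: "(UNIV - C) \<inter> A = A - C" "C \<inter> A = A \<inter> C" by auto
      show "hausdorff_outer k (C \<inter> A) + hausdorff_outer k ((UNIV - C) \<inter> A) \<le> hausdorff_outer k A"
        using hausdorff_caratheodory_closed[OF that False, of k A] by simp
      show "hausdorff_outer k A \<le> hausdorff_outer k (C \<inter> A) + hausdorff_outer k ((UNIV - C) \<inter> A)"
        using hausdorff_outer_Un_le[of k "A \<inter> C" "A - C"] by (simp add: Int_Diff_Un)
    qed
    then show ?thesis
      by (simp add: sets_hausdorff_measure lambda_system_def)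
  qed simp
  then show ?thesis
    unfolding borel_eq_closed
    using sets.sigma_sets_subset[of "Collect closed" "hausdorff_measure k :: 'a measure"]
    by (auto simp: space_hausdorff_measure)
qed

definition surf :: "(real^'n) measure" where
  "surf = hausdorff_measure (CARD('n) - 1)"

definition area :: "(real^'n) set \<Rightarrow> real" where
  "area A = measure surf A"

definition vol :: "(real^'n) set \<Rightarrow> real" where
  "vol A = measure lebesgue A"


section \<open>Function spaces, weak divergence, normal trace\<close>

definition L2_on :: "'a measure \<Rightarrow> 'a set \<Rightarrow> ('a \<Rightarrow> 'b::euclidean_space) \<Rightarrow> bool" where
  "L2_on M A f \<longleftrightarrow> set_borel_measurable M A f \<and> set_integrable M A (\<lambda>x. (norm (f x))\<^sup>2)"

definition L2_norm_on :: "'a measure \<Rightarrow> 'a set \<Rightarrow> ('a \<Rightarrow> 'b::euclidean_space) \<Rightarrow> real" where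
  "L2_norm_on M A f = sqrt (LINT x:A|M. (norm (f x))\<^sup>2)"

definition C1_closure :: "'a::euclidean_space set \<Rightarrow> ('a \<Rightarrow> real) \<Rightarrow> bool" where
  "C1_closure S \<phi> \<longleftrightarrow> continuous_on (closure S) \<phi> \<and>
     (\<exists>g. continuous_on (closure S) g \<and> (\<forall>x\<in>S. gderiv \<phi> x (g x)))"

definition gradient :: "('a::euclidean_space \<Rightarrow> real) \<Rightarrow> 'a \<Rightarrow> 'a" where
  "gradient \<phi> x = (THE g. gderiv \<phi> x g)"

definition C1_with_gradient :: "('a::euclidean_space \<Rightarrow> real) \<Rightarrow> ('a \<Rightarrow> 'a) \<Rightarrow> bool" where
  "C1_with_gradient \<psi> g \<longleftrightarrow> continuous_on UNIV g \<and> (\<forall>x. gderiv \<psi> x (g x))"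

definition has_weak_div :: "'a::euclidean_space set \<Rightarrow> ('a \<Rightarrow> 'a) \<Rightarrow> ('a \<Rightarrow> real) \<Rightarrow> bool" where
  "has_weak_div S V w \<longleftrightarrow> L2_on lebesgue S w \<and>
     (\<forall>\<psi> g. C1_with_gradient \<psi> g \<and> (\<exists>C. compact C \<and> C \<subseteq> S \<and> (\<forall>x. x \<notin> C \<longrightarrow> \<psi> x = 0)) \<longrightarrow>
        (LINT x:S|lebesgue. V x \<bullet> g x) = - (LINT x:S|lebesgue. w x * \<psi> x))"

definition Hdiv :: "'a::euclidean_space set \<Rightarrow> ('a \<Rightarrow> 'a) set" where
  "Hdiv S = {V. L2_on lebesgue S V \<and> (\<exists>w. has_weak_div S V w)}"

definition weak_div :: "'a::euclidean_space set \<Rightarrow> ('a \<Rightarrow> 'a) \<Rightarrow> 'a \<Rightarrow> real" where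
  "weak_div S V = (SOME w. has_weak_div S V w)"

text \<open>The outward normal trace \<open>V \<cdot> n\<close> on the boundary, characterised by Green's formula. For an
  essentially bounded \<open>V \<in> Hdiv S\<close> on a polytopal \<open>S\<close> it exists as an (essentially bounded)
  function, and it is unique up to a null set of the surface measure.\<close>

definition has_normal_trace ::
    "(real^'n) set \<Rightarrow> (real^'n \<Rightarrow> real^'n) \<Rightarrow> (real^'n \<Rightarrow> real) \<Rightarrow> bool" where
  "has_normal_trace S V \<gamma> \<longleftrightarrow> set_integrable surf (frontier S) \<gamma> \<and>
     (\<forall>\<psi> g. C1_with_gradient \<psi> g \<longrightarrow>
        (LINT x:S|lebesgue. V x \<bullet> g x) + (LINT x:S|lebesgue. weak_div S V x * \<psi> x) =
        (LINT x:frontier S|surf. \<gamma> x * \<psi> x))"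

definition normal_trace :: "(real^'n) set \<Rightarrow> (real^'n \<Rightarrow> real^'n) \<Rightarrow> real^'n \<Rightarrow> real" where
  "normal_trace S V = (SOME \<gamma>. has_normal_trace S V \<gamma>)"


section \<open>Continuous data\<close>

text \<open>Taking the interior of a finite union of polytopes excludes slits, on which no outward
  normal exists.\<close>

definition open_polytopal :: "(real^'n) set \<Rightarrow> bool" where
  "open_polytopal S \<longleftrightarrow> (\<exists>F. finite F \<and> (\<forall>P\<in>F. polytope P) \<and> S = interior (\<Union>F))"

record ('n::finite) problem =
  region :: "(real^'n) set"
  GD :: "(real^'n) set"
  GN :: "(real^'n) set"
  Lam :: "real^'n \<Rightarrow> real^'n^'n"
  lam_lo :: real
  lam_hi :: real
  pot :: "real^'n \<Rightarrow> real"
  src :: "real^'n \<Rightarrow> real"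
  neu :: "real^'n \<Rightarrow> real"
  ini :: "real^'n \<Rightarrow> real"

definition adv_field :: "'n::finite problem \<Rightarrow> real^'n \<Rightarrow> real^'n" where
  "adv_field P x = - (Lam P x *v gradient (pot P) x)"

definition is_domain :: "'n::finite problem \<Rightarrow> bool" where
  "is_domain P \<longleftrightarrow>
     open (region P) \<and> bounded (region P) \<and> connected (region P) \<and> open_polytopal (region P) \<and>
     frontier (region P) = closure (GD P) \<union> closure (GN P) \<and> GD P \<inter> GN P = {} \<and>
     openin (top_of_set (frontier (region P))) (GD P) \<and>
     openin (top_of_set (frontier (region P))) (GN P)"

definition is_diffusion :: "'n::finite problem \<Rightarrow> bool" where
  "is_diffusion P \<longleftrightarrow>
     set_borel_measurable lebesgue (region P) (Lam P) \<and>
     0 < lam_lo P \<and> lam_lo P \<le> lam_hi P \<and>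
     (AE x in lebesgue. x \<in> region P \<longrightarrow> transpose (Lam P x) = Lam P x \<and>
        (\<forall>\<xi>. lam_lo P * (norm \<xi>)\<^sup>2 \<le> \<xi> \<bullet> (Lam P x *v \<xi>)) \<and>
        (\<forall>\<xi>. norm (Lam P x *v \<xi>) \<le> lam_hi P * norm \<xi>))"

definition is_data :: "'n::finite problem \<Rightarrow> bool" where
  "is_data P \<longleftrightarrow>
     is_domain P \<and> is_diffusion P \<and>
     C1_closure (region P) (pot P) \<and> adv_field P \<in> Hdiv (region P) \<and>
     L2_on lebesgue (region P) (src P) \<and> L2_on surf (GN P) (neu P) \<and>
     L2_on lebesgue (region P) (ini P) \<and>
     (emeasure surf (GD P) = 0 \<longrightarrow>
        (LINT x:region P|lebesgue. src P x) + (LINT x:GN P|surf. neu P x) = 0 \<and>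
        (LINT x:region P|lebesgue. ini P x) = 0)"


section \<open>Discretisation\<close>

record ('n::finite) mesh =
  cells :: "(real^'n) set set"
  faces :: "(real^'n) set set"
  faces_of_cell :: "(real^'n) set \<Rightarrow> (real^'n) set set"
  center :: "(real^'n) set \<Rightarrow> real^'n"

definition cells_of_face :: "'n::finite mesh \<Rightarrow> (real^'n) set \<Rightarrow> (real^'n) set set" where
  "cells_of_face D \<sigma> = {K \<in> cells D. \<sigma> \<in> faces_of_cell D K}"

definition is_boundary_face :: "'n::finite problem \<Rightarrow> 'n mesh \<Rightarrow> (real^'n) set \<Rightarrow> bool" where
  "is_boundary_face P D \<sigma> \<longleftrightarrow> (\<exists>K. cells_of_face D \<sigma> = {K}) \<and> \<sigma> \<subseteq> frontier (region P)"

definition is_interface :: "'n::finite mesh \<Rightarrow> (real^'n) set \<Rightarrow> bool" where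
  "is_interface D \<sigma> \<longleftrightarrow> (\<exists>K L. K \<noteq> L \<and> cells_of_face D \<sigma> = {K, L})"

text \<open>A face is relatively open and nonempty in a hyperplane, which therefore is its affine hull.\<close>

definition face_dist :: "'n::finite mesh \<Rightarrow> (real^'n) set \<Rightarrow> (real^'n) set \<Rightarrow> real" where
  "face_dist D K \<sigma> = infdist (center D K) (affine hull \<sigma>)"

definition is_mesh :: "'n::finite problem \<Rightarrow> 'n mesh \<Rightarrow> bool" where
  "is_mesh P D \<longleftrightarrow>
     finite (cells D) \<and> disjoint (cells D) \<and>
     (\<forall>K\<in>cells D. K \<noteq> {} \<and> open K \<and> connected K \<and> open_polytopal K \<and> K \<subseteq> region P \<and> vol K > 0) \<and>
     closure (region P) = (\<Union>K\<in>cells D. closure K) \<and>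
     finite (faces D) \<and> disjoint (faces D) \<and>
     (\<forall>\<sigma>\<in>faces D. \<sigma> \<noteq> {} \<and> connected \<sigma> \<and> \<sigma> \<subseteq> closure (region P) \<and> area \<sigma> > 0 \<and>
        (\<exists>a b. a \<noteq> 0 \<and> openin (top_of_set {x. a \<bullet> x = b}) \<sigma>)) \<and>
     (\<Union>K\<in>cells D. frontier K) = (\<Union>\<sigma>\<in>faces D. closure \<sigma>) \<and>
     (\<forall>K\<in>cells D. faces_of_cell D K \<subseteq> faces D \<and>
        frontier K = (\<Union>\<sigma>\<in>faces_of_cell D K. closure \<sigma>)) \<and>
     (\<forall>\<sigma>\<in>faces D. is_boundary_face P D \<sigma> \<or> is_interface D \<sigma>) \<and>
     (\<forall>\<sigma>\<in>faces D. is_boundary_face P D \<sigma> \<longrightarrow> \<sigma> \<subseteq> GD P \<or> \<sigma> \<subseteq> GN P) \<and>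
     (\<forall>K\<in>cells D. center D K \<in> K \<and> (\<forall>y\<in>K. closed_segment (center D K) y \<subseteq> K) \<and>
        (\<forall>\<sigma>\<in>faces_of_cell D K. face_dist D K \<sigma> > 0))"

definition dirichlet_faces :: "'n::finite problem \<Rightarrow> 'n mesh \<Rightarrow> (real^'n) set set" where
  "dirichlet_faces P D = {\<sigma> \<in> faces D. is_boundary_face P D \<sigma> \<and> \<sigma> \<subseteq> GD P}"

definition barycentre :: "(real^'n) set \<Rightarrow> real^'n" where
  "barycentre \<sigma> = (1 / area \<sigma>) *\<^sub>R (LINT x:\<sigma>|surf. x)"

definition outward_normal :: "(real^'n) set \<Rightarrow> (real^'n) set \<Rightarrow> real^'n" where
  "outward_normal K \<sigma> = (THE n. norm n = 1 \<and> (\<forall>x\<in>\<sigma>. \<forall>y\<in>\<sigma>. n \<bullet> (y - x) = 0) \<and>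
     (\<forall>x\<in>\<sigma>. \<forall>\<^sub>F t in at_right 0. x - t *\<^sub>R n \<in> K \<and> x + t *\<^sub>R n \<notin> K))"

definition pyramid :: "'n::finite mesh \<Rightarrow> (real^'n) set \<Rightarrow> (real^'n) set \<Rightarrow> (real^'n) set" where
  "pyramid D K \<sigma> = {center D K + t *\<^sub>R (y - center D K) | t y. 0 < t \<and> t < 1 \<and> y \<in> \<sigma>}"


section \<open>Hybrid unknowns\<close>

text \<open>A vector of unknowns is a pair of functions, giving the values on cells and on faces; its
  values on sets that are not cells, respectively faces, of the mesh are never used. Differences
  are the componentwise ones of the product and function types.\<close>

type_synonym 'n unknowns = "((real^'n) set \<Rightarrow> real) \<times> ((real^'n) set \<Rightarrow> real)"

abbreviation cval :: "'n::finite unknowns \<Rightarrow> (real^'n) set \<Rightarrow> real" where "cval \<equiv> fst"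
abbreviation fval :: "'n::finite unknowns \<Rightarrow> (real^'n) set \<Rightarrow> real" where "fval \<equiv> snd"

definition cell_fun :: "'n::finite mesh \<Rightarrow> 'n unknowns \<Rightarrow> real^'n \<Rightarrow> real" where
  "cell_fun D v x = (\<Sum>K\<in>cells D. cval v K * indicator K x)"

definition face_fun :: "'n::finite mesh \<Rightarrow> 'n unknowns \<Rightarrow> real^'n \<Rightarrow> real" where
  "face_fun D v x = (\<Sum>\<sigma>\<in>faces D. fval v \<sigma> * indicator \<sigma> x)"

definition V0 :: "'n::finite problem \<Rightarrow> 'n mesh \<Rightarrow> 'n unknowns set" where
  "V0 P D = (if emeasure surf (GD P) = 0
     then {v. (LINT x:region P|lebesgue. cell_fun D v x) = 0}
     else {v. \<forall>\<sigma>\<in>dirichlet_faces P D. fval v \<sigma> = 0})"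

definition cell_seminorm_sq :: "'n::finite mesh \<Rightarrow> (real^'n) set \<Rightarrow> 'n unknowns \<Rightarrow> real" where
  "cell_seminorm_sq D K v =
     (\<Sum>\<sigma>\<in>faces_of_cell D K. area \<sigma> / face_dist D K \<sigma> * (cval v K - fval v \<sigma>)\<^sup>2)"

definition seminorm :: "'n::finite mesh \<Rightarrow> 'n unknowns \<Rightarrow> real" where
  "seminorm D v = sqrt (\<Sum>K\<in>cells D. cell_seminorm_sq D K v)"


section \<open>Discrete forms\<close>

definition G_cell :: "'n::finite mesh \<Rightarrow> (real^'n) set \<Rightarrow> 'n unknowns \<Rightarrow> real^'n" where
  "G_cell D K v = (1 / vol K) *\<^sub>R
     (\<Sum>\<sigma>\<in>faces_of_cell D K. (area \<sigma> * (fval v \<sigma> - cval v K)) *\<^sub>R outward_normal K \<sigma>)"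

text \<open>The pyramids of a cell are disjoint and cover it up to a null set, so the sum below has at
  most one nonzero term.\<close>

definition grad_cell ::
    "real \<Rightarrow> 'n::finite mesh \<Rightarrow> (real^'n) set \<Rightarrow> 'n unknowns \<Rightarrow> real^'n \<Rightarrow> real^'n" where
  "grad_cell \<eta> D K v x = (\<Sum>\<sigma>\<in>faces_of_cell D K. indicator (pyramid D K \<sigma>) x *\<^sub>R
     (G_cell D K v +
      (\<eta> / face_dist D K \<sigma> *
        (fval v \<sigma> - cval v K - G_cell D K v \<bullet> (barycentre \<sigma> - center D K)))
       *\<^sub>R outward_normal K \<sigma>))"

definition a_diff_cell ::
    "'n::finite problem \<Rightarrow> real \<Rightarrow> 'n mesh \<Rightarrow> (real^'n) set \<Rightarrow> 'n unknowns \<Rightarrow> 'n unknowns \<Rightarrow> real" where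
  "a_diff_cell P \<eta> D K u v =
     (LINT x:K|lebesgue. (Lam P x *v grad_cell \<eta> D K u x) \<bullet> grad_cell \<eta> D K v x)"

definition face_velocity ::
    "'n::finite problem \<Rightarrow> (real^'n) set \<Rightarrow> (real^'n) set \<Rightarrow> real" where
  "face_velocity P K \<sigma> = (1 / area \<sigma>) * (LINT x:\<sigma>|surf. normal_trace K (adv_field P) x)"

definition Lam_cell :: "'n::finite problem \<Rightarrow> (real^'n) set \<Rightarrow> real^'n^'n" where
  "Lam_cell P K = (1 / vol K) *\<^sub>R (LINT x:K|lebesgue. Lam P x)"

definition spectrum :: "real^'n^'n \<Rightarrow> real set" where
  "spectrum B = {s. \<exists>v. v \<noteq> 0 \<and> B *v v = s *\<^sub>R v}"

definition mu_face :: "'n::finite problem \<Rightarrow> 'n mesh \<Rightarrow> (real^'n) set \<Rightarrow> real" where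
  "mu_face P D \<sigma> = Min (insert 1 (\<Union>K\<in>cells_of_face D \<sigma>. spectrum (Lam_cell P K)))"

definition adv_flux ::
    "'n::finite problem \<Rightarrow> (real \<Rightarrow> real) \<Rightarrow> 'n mesh \<Rightarrow> (real^'n) set \<Rightarrow> (real^'n) set \<Rightarrow>
     'n unknowns \<Rightarrow> real" where
  "adv_flux P A D K \<sigma> u =
     (let d = face_dist D K \<sigma>; \<mu> = mu_face P D \<sigma>; V = face_velocity P K \<sigma>
      in area \<sigma> * (\<mu> / d) * (A (- (d / \<mu> * V)) * cval u K - A (d / \<mu> * V) * fval u \<sigma>))"

definition a_adv_cell ::
    "'n::finite problem \<Rightarrow> (real \<Rightarrow> real) \<Rightarrow> 'n mesh \<Rightarrow> (real^'n) set \<Rightarrow>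
     'n unknowns \<Rightarrow> 'n unknowns \<Rightarrow> real" where
  "a_adv_cell P A D K u v =
     (\<Sum>\<sigma>\<in>faces_of_cell D K. adv_flux P A D K \<sigma> u * (cval v K - fval v \<sigma>))"

definition is_adv_function :: "(real \<Rightarrow> real) \<Rightarrow> bool" where
  "is_adv_function A \<longleftrightarrow> (\<exists>L. L-lipschitz_on UNIV A) \<and> A 0 = 0 \<and>
     (\<forall>s. A (- s) - A s = s) \<and> (\<forall>s. A (- s) + A s \<ge> 0)"

definition a_form ::
    "'n::finite problem \<Rightarrow> real \<Rightarrow> (real \<Rightarrow> real) \<Rightarrow> 'n mesh \<Rightarrow>
     'n unknowns \<Rightarrow> 'n unknowns \<Rightarrow> real" where
  "a_form P \<eta> A D u v = (\<Sum>K\<in>cells D. a_diff_cell P \<eta> D K u v + a_adv_cell P A D K u v)"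

definition load :: "'n::finite problem \<Rightarrow> 'n mesh \<Rightarrow> 'n unknowns \<Rightarrow> real" where
  "load P D v =
     (LINT x:region P|lebesgue. src P x * cell_fun D v x) + (LINT x:GN P|surf. neu P x * face_fun D v x)"


section \<open>Schemes and constants\<close>

definition stationary_solution ::
    "'n::finite problem \<Rightarrow> real \<Rightarrow> (real \<Rightarrow> real) \<Rightarrow> 'n mesh \<Rightarrow> 'n unknowns \<Rightarrow> bool" where
  "stationary_solution P \<eta> A D u \<longleftrightarrow>
     u \<in> V0 P D \<and> (\<forall>v\<in>V0 P D. a_form P \<eta> A D u v = load P D v)"

text \<open>Only the cell values of \<open>u 0\<close> are prescribed; its face values play no role.\<close>

definition evolution_solution ::
    "'n::finite problem \<Rightarrow> real \<Rightarrow> (real \<Rightarrow> real) \<Rightarrow> 'n mesh \<Rightarrow> real \<Rightarrow>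
     (nat \<Rightarrow> 'n unknowns) \<Rightarrow> bool" where
  "evolution_solution P \<eta> A D \<Delta>t u \<longleftrightarrow>
     (\<forall>K\<in>cells D. cval (u 0) K = (1 / vol K) * (LINT x:K|lebesgue. ini P x)) \<and>
     (\<forall>n\<ge>1. u n \<in> V0 P D \<and>
       (\<forall>v\<in>V0 P D.
          (1 / \<Delta>t) * (LINT x:region P|lebesgue.
              (cell_fun D (u n) x - cell_fun D (u (n - 1)) x) * cell_fun D v x)
          + a_form P \<eta> A D (u n) v = load P D v))"

text \<open>The constants are arbitrary numbers satisfying the defining inequality on the given mesh;
  this includes the ones that are uniform with respect to the mesh regularity.\<close>

definition grad_stability_const :: "real \<Rightarrow> 'n::finite mesh \<Rightarrow> real \<Rightarrow> bool" where
  "grad_stability_const \<eta> D \<alpha> \<longleftrightarrow> \<alpha> > 0 \<and>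
     (\<forall>K\<in>cells D. \<forall>v. \<alpha> * cell_seminorm_sq D K v \<le> (L2_norm_on lebesgue K (grad_cell \<eta> D K v))\<^sup>2)"

definition poincare_const :: "'n::finite problem \<Rightarrow> 'n mesh \<Rightarrow> real \<Rightarrow> bool" where
  "poincare_const P D C \<longleftrightarrow> C > 0 \<and>
     (\<forall>v\<in>V0 P D. L2_norm_on lebesgue (region P) (cell_fun D v) \<le> C * seminorm D v)"

definition coercivity_const ::
    "'n::finite problem \<Rightarrow> real \<Rightarrow> (real \<Rightarrow> real) \<Rightarrow> 'n mesh \<Rightarrow> real \<Rightarrow> bool" where
  "coercivity_const P \<eta> A D \<kappa> \<longleftrightarrow> \<kappa> > 0 \<and>
     (\<forall>v\<in>V0 P D. a_form P \<eta> A D v v \<ge> \<kappa> * (seminorm D v)\<^sup>2)"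

definition rel_energy ::
    "'n::finite problem \<Rightarrow> 'n mesh \<Rightarrow> (nat \<Rightarrow> 'n unknowns) \<Rightarrow> 'n unknowns \<Rightarrow> nat \<Rightarrow> real" where
  "rel_energy P D u w n =
     1 / 2 * (L2_norm_on lebesgue (region P) (\<lambda>x. cell_fun D (u n) x - cell_fun D w x))\<^sup>2"

definition dissipation ::
    "'n::finite problem \<Rightarrow> real \<Rightarrow> (real \<Rightarrow> real) \<Rightarrow> 'n mesh \<Rightarrow>
     (nat \<Rightarrow> 'n unknowns) \<Rightarrow> 'n unknowns \<Rightarrow> nat \<Rightarrow> real" where
  "dissipation P \<eta> A D u w n = a_form P \<eta> A D (u n - w) (u n - w)"

end

theory Submission
  imports Defs
begin

text \<open>
  The proof is the discrete version of the relative entropy (here: relative energy) argument. Write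
  \<open>e n = u n - w\<close> for the distance of the evolution to the stationary state. The two schemes have
  the same right-hand side and the form is linear in its first argument, so subtracting them shows
  that \<open>e\<close> solves the evolution scheme with zero right-hand side. As the space of test vectors is
  stable under differences, \<open>e (n + 1)\<close> is itself an admissible test vector; it gives
  \<open>(e (n + 1) - e n, e (n + 1)) / \<Delta>t + dissipation (n + 1) = 0\<close>, where the inner product is that of
  the cell functions. Since \<open>(a\<^sup>2 - b\<^sup>2) / 2 \<le> (a - b) * a\<close>, the first term bounds the increment of
  the relative energy from above, and the first claim follows. Coercivity bounds the dissipation
  from below by a multiple of the squared discrete seminorm, and the Poincare inequality turns this
  into \<open>\<nu>\<close> times the relative energy. So the energy decreases at least by the factor
  \<open>1 / (1 + \<nu> * \<Delta>t)\<close> in each step, and the last claim is the square root of the iterated bound.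

  What is analytic in this argument is that the integrals involved are additive, that is, that their
  integrands are integrable. For products of cell functions this is clear, as these are bounded on a
  bounded set. For the diffusive form (\<open>set_integrable_diffusion_integrand\<close>) it rests on the bound on
  the diffusion tensor and on the measurability of the discrete gradient, which is piecewise
  constant on the pyramids; these are measurable because they are open (\<open>open_pyramid\<close>).
\<close>


section \<open>Openness of the pyramids\<close>

text \<open>Outside the hyperplane through its apex \<open>p\<close> parallel to the base, a point \<open>x\<close> lies on a unique
  line through \<open>p\<close> that meets the hyperplane of the base. The ratio \<open>\<tau> x\<close> at which \<open>x\<close> divides the
  way from \<open>p\<close> to the meeting point, and this point itself, depend continuously on \<open>x\<close>; the pyramid
  is a preimage of open sets under the two.\<close>

lemma open_pyramid_over_relatively_open:
  fixes p :: "'a::euclidean_space"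
  assumes S: "openin (top_of_set {x. a \<bullet> x = b}) S" and p: "a \<bullet> p \<noteq> b"
  shows "open {p + t *\<^sub>R (y - p) | t y. 0 < t \<and> t < 1 \<and> y \<in> S}"
proof -
  obtain T where T: "open T" "S = {x. a \<bullet> x = b} \<inter> T"
    using S by (auto simp: openin_open)
  define \<tau> where "\<tau> x = (a \<bullet> (x - p)) / (b - a \<bullet> p)" for x
  define U where "U = {x. 0 < \<tau> x} \<inter> {x. \<tau> x < 1}"
  have cont: "continuous_on X \<tau>" for X
    unfolding \<tau>_def using p by (intro continuous_intros) auto
  have U: "open U"
    unfolding U_def by (intro open_Int open_Collect_less cont continuous_on_const)
  have "continuous_on U (\<lambda>x. p + (1 / \<tau> x) *\<^sub>R (x - p))"
    by (intro continuous_intros cont) (auto simp: U_def)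
  then have "open (U \<inter> (\<lambda>x. p + (1 / \<tau> x) *\<^sub>R (x - p)) -` T)"
    using U T(1) by (rule continuous_open_preimage)
  also have "U \<inter> (\<lambda>x. p + (1 / \<tau> x) *\<^sub>R (x - p)) -` T =
      {p + t *\<^sub>R (y - p) | t y. 0 < t \<and> t < 1 \<and> y \<in> S}" (is "?L = ?R")
  proof (intro equalityI subsetI)
    fix x assume x: "x \<in> ?L"
    define y where "y = p + (1 / \<tau> x) *\<^sub>R (x - p)"
    have pos: "0 < \<tau> x" "\<tau> x < 1" and "y \<in> T"
      using x by (auto simp: U_def y_def)
    have "a \<bullet> (x - p) = \<tau> x * (b - a \<bullet> p)"
      using p by (simp add: \<tau>_def)
    then have "a \<bullet> y = b"
      using pos by (simp add: y_def inner_add_right)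
    moreover have "x = p + \<tau> x *\<^sub>R (y - p)"
      using pos by (simp add: y_def)
    ultimately show "x \<in> ?R"
      using pos \<open>y \<in> T\<close> T(2) by blast
  next
    fix x assume "x \<in> ?R"
    then obtain t y where ty: "x = p + t *\<^sub>R (y - p)" "0 < t" "t < 1" "y \<in> S"
      by blast
    have "a \<bullet> y = b" "y \<in> T"
      using ty(4) T(2) by auto
    then have "\<tau> x = t"
      using p by (simp add: \<tau>_def ty(1) inner_diff_right)
    then show "x \<in> ?L"
      using ty \<open>y \<in> T\<close> by (simp add: U_def)
  qed
  finally show ?thesis .
qed

lemma open_pyramid:
  assumes mesh: "is_mesh P D" and K: "K \<in> cells D" and \<sigma>: "\<sigma> \<in> faces_of_cell D K"
  shows "open (pyramid D K \<sigma>)"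
proof -
  have "\<sigma> \<in> faces D" and d: "face_dist D K \<sigma> > 0"
    using assms by (auto simp: is_mesh_def)
  then have "\<exists>a b. a \<noteq> 0 \<and> openin (top_of_set {x. a \<bullet> x = b}) \<sigma>" and "\<sigma> \<noteq> {}"
    using mesh by (simp_all add: is_mesh_def)
  then obtain a b where ab: "openin (top_of_set {x. a \<bullet> x = b}) \<sigma>"
    by blast
  have "affine hull {x. a \<bullet> x = b} = {x. a \<bullet> x = b}"
    by (rule hull_same) (rule affine_hyperplane)
  then have "affine hull \<sigma> = {x. a \<bullet> x = b}"
    using affine_hull_openin[of "{x. a \<bullet> x = b}" \<sigma>] ab \<open>\<sigma> \<noteq> {}\<close> by metis
  then have "a \<bullet> center D K \<noteq> b"
    using d by (auto simp: face_dist_def)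
  then show ?thesis
    unfolding pyramid_def by (rule open_pyramid_over_relatively_open[OF ab])
qed


section \<open>Cell functions\<close>

lemma cell_fun_diff: "cell_fun D (u - v) = (\<lambda>x. cell_fun D u x - cell_fun D v x)"
  by (simp add: fun_eq_iff cell_fun_def left_diff_distrib sum_subtractf)

lemma borel_measurable_cell_fun:
  assumes "is_mesh P D"
  shows "cell_fun D v \<in> borel_measurable lebesgue"
  unfolding cell_fun_def using assms
  by (intro borel_measurable_sum borel_measurable_times borel_measurable_const
      borel_measurable_indicator) (auto simp: is_mesh_def)

lemma abs_cell_fun_le: "\<bar>cell_fun D v x\<bar> \<le> (\<Sum>K\<in>cells D. \<bar>cval v K\<bar>)"
  unfolding cell_fun_def
  by (rule order_trans[OF sum_abs sum_mono]) (auto simp: indicator_def)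

lemma set_integrable_bounded_measurable:
  fixes f :: "'a::euclidean_space \<Rightarrow> real"
  assumes S: "open S" "bounded S"
    and f: "set_borel_measurable lebesgue S f"
    and bound: "AE x in lebesgue. x \<in> S \<longrightarrow> \<bar>f x\<bar> \<le> B"
  shows "set_integrable lebesgue S f"
  unfolding set_integrable_def
proof (rule integrableI_bounded_set)
  show "S \<in> sets lebesgue"
    using S by auto
  show "emeasure lebesgue S < \<infinity>"
    using emeasure_bounded_finite[OF S(2)] S(1) by simp
  show "(\<lambda>x. indicat_real S x *\<^sub>R f x) \<in> borel_measurable lebesgue"
    using f by (simp add: set_borel_measurable_def)
  show "AE x in lebesgue. x \<in> S \<longrightarrow> norm (indicat_real S x *\<^sub>R f x) \<le> B"
    using bound by eventually_elim auto
qed auto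

context
  fixes P :: "'n::finite problem" and D :: "'n mesh"
  assumes data: "is_data P" and mesh: "is_mesh P D"
begin

lemma domain_open_bounded: "open (region P)" "bounded (region P)"
  using data by (auto simp: is_data_def is_domain_def)

lemma set_integrable_cell_fun: "set_integrable lebesgue (region P) (cell_fun D v)"
  using domain_open_bounded
proof (rule set_integrable_bounded_measurable)
  show "set_borel_measurable lebesgue (region P) (cell_fun D v)"
    unfolding set_borel_measurable_def using domain_open_bounded
    by (intro borel_measurable_scaleR borel_measurable_indicator
        borel_measurable_cell_fun[OF mesh]) auto
qed (use abs_cell_fun_le in blast)

lemma set_integrable_cell_fun_mult:
  "set_integrable lebesgue (region P) (\<lambda>x. cell_fun D u x * cell_fun D v x)"
  using domain_open_bounded
proof (rule set_integrable_bounded_measurable)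
  show "set_borel_measurable lebesgue (region P) (\<lambda>x. cell_fun D u x * cell_fun D v x)"
    unfolding set_borel_measurable_def using domain_open_bounded
    by (intro borel_measurable_scaleR borel_measurable_indicator borel_measurable_times
        borel_measurable_cell_fun[OF mesh]) auto
  show "AE x in lebesgue. x \<in> region P \<longrightarrow> \<bar>cell_fun D u x * cell_fun D v x\<bar>
      \<le> (\<Sum>K\<in>cells D. \<bar>cval u K\<bar>) * (\<Sum>K\<in>cells D. \<bar>cval v K\<bar>)"
    unfolding abs_mult
    by (intro AE_I2 impI mult_mono abs_cell_fun_le sum_nonneg) auto
qed

lemma V0_diff:
  assumes "u \<in> V0 P D" "v \<in> V0 P D"
  shows "u - v \<in> V0 P D"
  using assms
  by (auto simp: V0_def cell_fun_diff set_integral_diff set_integrable_cell_fun split: if_splits)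


section \<open>Linearity of the form in its first argument\<close>

lemma G_cell_diff: "G_cell D K (u - v) = G_cell D K u - G_cell D K v"
proof -
  have "area \<sigma> * (fval (u - v) \<sigma> - cval (u - v) K) =
      area \<sigma> * (fval u \<sigma> - cval u K) - area \<sigma> * (fval v \<sigma> - cval v K)" for \<sigma>
    by (simp add: algebra_simps)
  then show ?thesis
    unfolding G_cell_def by (simp only: scaleR_diff_left sum_subtractf scaleR_diff_right)
qed

lemma grad_cell_diff: "grad_cell \<eta> D K (u - v) x = grad_cell \<eta> D K u x - grad_cell \<eta> D K v x"
proof -
  have defect: "fval (u - v) \<sigma> - cval (u - v) K - (G_cell D K u - G_cell D K v) \<bullet> z =
      (fval u \<sigma> - cval u K - G_cell D K u \<bullet> z) - (fval v \<sigma> - cval v K - G_cell D K v \<bullet> z)" for \<sigma> z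
    by (simp add: inner_diff_left)
  have lin: "s *\<^sub>R ((G - G') + (c * (r - r')) *\<^sub>R y) =
      s *\<^sub>R (G + (c * r) *\<^sub>R y) - s *\<^sub>R (G' + (c * r') *\<^sub>R y)"
    for s c r r' :: real and G G' y :: "real^'n"
    by (simp add: algebra_simps)
  show ?thesis
    unfolding grad_cell_def by (simp only: G_cell_diff defect lin sum_subtractf)
qed

lemma borel_measurable_grad_cell:
  assumes "K \<in> cells D"
  shows "grad_cell \<eta> D K v \<in> borel_measurable lebesgue"
  unfolding grad_cell_def using open_pyramid[OF mesh assms]
  by (intro borel_measurable_sum borel_measurable_scaleR borel_measurable_const
      borel_measurable_indicator) auto

lemma grad_cell_bounded: "\<exists>B. \<forall>x. norm (grad_cell \<eta> D K v x) \<le> B"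
proof (intro exI allI)
  let ?g = "\<lambda>\<sigma>. G_cell D K v + (\<eta> / face_dist D K \<sigma> *
      (fval v \<sigma> - cval v K - G_cell D K v \<bullet> (barycentre \<sigma> - center D K))) *\<^sub>R outward_normal K \<sigma>"
  show "norm (grad_cell \<eta> D K v x) \<le> (\<Sum>\<sigma>\<in>faces_of_cell D K. norm (?g \<sigma>))" for x
    unfolding grad_cell_def
    by (rule order_trans[OF norm_sum sum_mono]) (auto simp: indicator_def)
qed

text \<open>Both gradients take finitely many values and the diffusion tensor is essentially bounded on the
  domain in operator norm, so the integrand is essentially bounded, and cells are bounded sets.\<close>

lemma set_integrable_diffusion_integrand:
  assumes K: "K \<in> cells D"
  shows "set_integrable lebesgue K
    (\<lambda>x. (Lam P x *v grad_cell \<eta> D K u x) \<bullet> grad_cell \<eta> D K v x)"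
proof -
  have KS: "open K" "K \<subseteq> region P"
    using mesh K by (auto simp: is_mesh_def)
  have "bounded K"
    using KS(2) domain_open_bounded bounded_subset by blast
  obtain B where B: "\<And>x. norm (grad_cell \<eta> D K u x) \<le> B"
    using grad_cell_bounded by blast
  obtain C where C: "\<And>x. norm (grad_cell \<eta> D K v x) \<le> C"
    using grad_cell_bounded by blast
  have dif: "is_diffusion P"
    using data by (simp add: is_data_def)
  \<comment> \<open>Measurability of the tensor is an assumption on its extension by zero outside of the domain, so
    the argument is carried out for this extension, which agrees with the tensor on \<open>K\<close>.\<close>
  have [measurable]: "(\<lambda>x. indicat_real (region P) x *\<^sub>R Lam P x) \<in> borel_measurable lebesgue"
    using dif by (simp add: is_diffusion_def set_borel_measurable_def)
  have [measurable]: "grad_cell \<eta> D K u \<in> borel_measurable lebesgue"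
      "grad_cell \<eta> D K v \<in> borel_measurable lebesgue"
    using borel_measurable_grad_cell[OF K] by auto
  have "continuous_on UNIV (\<lambda>(M, y). M *v y :: real^'n)"
    unfolding matrix_vector_mult_def case_prod_beta by (intro continuous_intros)
  then have mv: "(\<lambda>x. (indicat_real (region P) x *\<^sub>R Lam P x) *v grad_cell \<eta> D K u x)
      \<in> borel_measurable lebesgue"
    by (intro borel_measurable_continuous_Pair[where H = "\<lambda>M y. M *v y :: real^'n"])
      (simp_all add: case_prod_beta)
  have "(\<lambda>x. indicat_real K x *\<^sub>R
      (((indicat_real (region P) x *\<^sub>R Lam P x) *v grad_cell \<eta> D K u x) \<bullet> grad_cell \<eta> D K v x))
      \<in> borel_measurable lebesgue"
    using KS(1) by (intro borel_measurable_scaleR borel_measurable_indicator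
        borel_measurable_inner mv) auto
  also have "(\<lambda>x. indicat_real K x *\<^sub>R
      (((indicat_real (region P) x *\<^sub>R Lam P x) *v grad_cell \<eta> D K u x) \<bullet> grad_cell \<eta> D K v x))
    = (\<lambda>x. indicat_real K x *\<^sub>R ((Lam P x *v grad_cell \<eta> D K u x) \<bullet> grad_cell \<eta> D K v x))"
    using KS(2) by (auto simp: fun_eq_iff indicator_def)
  finally have meas: "set_borel_measurable lebesgue K
      (\<lambda>x. (Lam P x *v grad_cell \<eta> D K u x) \<bullet> grad_cell \<eta> D K v x)"
    by (simp add: set_borel_measurable_def)
  have "AE x in lebesgue. x \<in> region P \<longrightarrow> (\<forall>\<xi>. norm (Lam P x *v \<xi>) \<le> lam_hi P * norm \<xi>)"
    using dif unfolding is_diffusion_def by (auto elim: eventually_mono)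
  then have "AE x in lebesgue. x \<in> K \<longrightarrow>
      \<bar>(Lam P x *v grad_cell \<eta> D K u x) \<bullet> grad_cell \<eta> D K v x\<bar> \<le> lam_hi P * B * C"
  proof eventually_elim
    case (elim x)
    show ?case
    proof
      assume "x \<in> K"
      have "0 \<le> lam_hi P"
        using dif by (auto simp: is_diffusion_def)
      have "\<bar>(Lam P x *v grad_cell \<eta> D K u x) \<bullet> grad_cell \<eta> D K v x\<bar>
          \<le> norm (Lam P x *v grad_cell \<eta> D K u x) * norm (grad_cell \<eta> D K v x)"
        by (rule Cauchy_Schwarz_ineq2)
      also have "\<dots> \<le> lam_hi P * B * C"
      proof (rule mult_mono')
        have "norm (Lam P x *v grad_cell \<eta> D K u x) \<le> lam_hi P * norm (grad_cell \<eta> D K u x)"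
          using elim \<open>x \<in> K\<close> KS(2) by blast
        also have "\<dots> \<le> lam_hi P * B"
          using \<open>0 \<le> lam_hi P\<close> B by (rule mult_left_mono[rotated])
        finally show "norm (Lam P x *v grad_cell \<eta> D K u x) \<le> lam_hi P * B" .
      qed (use C in auto)
      finally show "\<bar>(Lam P x *v grad_cell \<eta> D K u x) \<bullet> grad_cell \<eta> D K v x\<bar> \<le> lam_hi P * B * C" .
    qed
  qed
  with KS(1) \<open>bounded K\<close> meas show ?thesis
    by (rule set_integrable_bounded_measurable)
qed

lemma a_diff_cell_diff:
  assumes "K \<in> cells D"
  shows "a_diff_cell P \<eta> D K (u - w) v = a_diff_cell P \<eta> D K u v - a_diff_cell P \<eta> D K w v"
  unfolding a_diff_cell_def grad_cell_diff
  by (simp add: matrix_vector_mult_diff_distrib inner_diff_left set_integral_diff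
      set_integrable_diffusion_integrand[OF assms])

lemma a_adv_cell_diff:
  "a_adv_cell P A D K (u - w) v = a_adv_cell P A D K u v - a_adv_cell P A D K w v"
proof -
  have "adv_flux P A D K \<sigma> (u - w) = adv_flux P A D K \<sigma> u - adv_flux P A D K \<sigma> w" for \<sigma>
    by (simp add: adv_flux_def Let_def right_diff_distrib diff_divide_distrib)
  then show ?thesis
    by (simp add: a_adv_cell_def left_diff_distrib sum_subtractf)
qed

lemma a_form_diff: "a_form P \<eta> A D (u - w) v = a_form P \<eta> A D u v - a_form P \<eta> A D w v"
  by (simp add: a_form_def a_diff_cell_diff a_adv_cell_diff sum.distrib sum_subtractf)


section \<open>Energy dissipation\<close>

lemma L2_norm_cell_fun_diff_sq:
  "(L2_norm_on lebesgue (region P) (\<lambda>x. cell_fun D u x - cell_fun D w x))\<^sup>2 =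
     (LINT x:region P|lebesgue. cell_fun D (u - w) x * cell_fun D (u - w) x)"
proof -
  have "0 \<le> (LINT x:region P|lebesgue. cell_fun D (u - w) x * cell_fun D (u - w) x)"
    unfolding set_lebesgue_integral_def by (intro Bochner_Integration.integral_nonneg) simp
  then show ?thesis
    by (simp add: L2_norm_on_def cell_fun_diff power2_eq_square)
qed

text \<open>The reason is \<open>(a\<^sup>2 - b\<^sup>2) / 2 = (a - b) * a - (a - b)\<^sup>2 / 2\<close>, integrated over the domain with \<open>a\<close>
  and \<open>b\<close> the distances to \<open>w\<close> at the new and the old time: the implicit Euler method dissipates
  the additional square.\<close>

lemma rel_energy_increment_le:
  "rel_energy P D u w (n + 1) - rel_energy P D u w n \<le>
     (LINT x:region P|lebesgue.
        (cell_fun D (u (n + 1)) x - cell_fun D (u n) x) * cell_fun D (u (n + 1) - w) x)"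
proof -
  let ?a = "cell_fun D (u (n + 1) - w)" and ?b = "cell_fun D (u n - w)"
  let ?I = "\<lambda>f. LINT x:region P|lebesgue. f x"
  note int = set_integrable_cell_fun_mult
  have "?I (\<lambda>x. ?a x * ?a x) - ?I (\<lambda>x. ?b x * ?b x) = ?I (\<lambda>x. ?a x * ?a x - ?b x * ?b x)"
    by (simp add: set_integral_diff int)
  also have "\<dots> \<le> ?I (\<lambda>x. 2 * (?a x * ?a x - ?b x * ?a x))"
  proof (rule set_integral_mono)
    show "?a x * ?a x - ?b x * ?b x \<le> 2 * (?a x * ?a x - ?b x * ?a x)" for x
      using zero_le_square[of "?a x - ?b x"] by (simp add: algebra_simps)
  qed (intro set_integral_diff set_integrable_mult_right int)+
  also have "\<dots> = 2 * ?I (\<lambda>x. ?a x * ?a x - ?b x * ?a x)"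
    by (rule set_integral_mult_right)
  finally show ?thesis
    by (simp add: rel_energy_def L2_norm_cell_fun_diff_sq) (simp add: cell_fun_diff algebra_simps)
qed

text \<open>The difference of the two schemes is tested with the new distance to the stationary state.\<close>

lemma energy_dissipation:
  assumes dt: "\<Delta>t > 0"
    and evolution: "evolution_solution P \<eta> A D \<Delta>t u"
    and stationary: "stationary_solution P \<eta> A D w"
  shows "(rel_energy P D u w (n + 1) - rel_energy P D u w n) / \<Delta>t
      + dissipation P \<eta> A D u w (n + 1) \<le> 0"
proof -
  let ?e = "u (n + 1) - w"
  let ?I = "LINT x:region P|lebesgue.
      (cell_fun D (u (n + 1)) x - cell_fun D (u n) x) * cell_fun D ?e x"
  have e: "?e \<in> V0 P D"
    using evolution stationary
    by (intro V0_diff) (auto simp: evolution_solution_def stationary_solution_def)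
  have "(1 / \<Delta>t) * ?I + a_form P \<eta> A D (u (n + 1)) ?e = load P D ?e"
    using conjunct2[OF evolution[unfolded evolution_solution_def], THEN spec, of "n + 1"] e
    by simp
  moreover have "a_form P \<eta> A D w ?e = load P D ?e"
    using stationary e by (simp add: stationary_solution_def)
  ultimately have "?I / \<Delta>t + dissipation P \<eta> A D u w (n + 1) = 0"
    by (simp add: dissipation_def a_form_diff)
  moreover have "(rel_energy P D u w (n + 1) - rel_energy P D u w n) / \<Delta>t \<le> ?I / \<Delta>t"
    using dt rel_energy_increment_le by (intro divide_right_mono) auto
  ultimately show ?thesis
    by linarith
qed

text \<open>Coercivity and the Poincare inequality combine to \<open>\<kappa> / C\<^sup>2\<close> times the squared norm; the factor 2
  is due to the energy being half of the squared norm.\<close>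

lemma rel_energy_le_dissipation:
  assumes C: "poincare_const P D C" and \<kappa>: "coercivity_const P \<eta> A D \<kappa>"
    and e: "u n - w \<in> V0 P D"
  shows "2 * \<kappa> / C\<^sup>2 * rel_energy P D u w n \<le> dissipation P \<eta> A D u w n"
proof -
  have pos: "C > 0" "\<kappa> > 0"
    using C \<kappa> by (auto simp: poincare_const_def coercivity_const_def)
  let ?N = "L2_norm_on lebesgue (region P) (cell_fun D (u n - w))"
  have N: "?N = L2_norm_on lebesgue (region P) (\<lambda>x. cell_fun D (u n) x - cell_fun D w x)"
    by (simp add: cell_fun_diff)
  have "0 \<le> ?N"
    unfolding L2_norm_on_def set_lebesgue_integral_def
    by (intro real_sqrt_ge_zero Bochner_Integration.integral_nonneg) simp
  moreover have "?N \<le> C * seminorm D (u n - w)"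
    using C e by (simp add: poincare_const_def)
  ultimately have "?N\<^sup>2 \<le> C\<^sup>2 * (seminorm D (u n - w))\<^sup>2"
    by (subst power_mult_distrib[symmetric]) (rule power_mono)
  then have "\<kappa> * (?N\<^sup>2 / C\<^sup>2) \<le> \<kappa> * (seminorm D (u n - w))\<^sup>2"
    using pos by (intro mult_left_mono) (auto simp: divide_le_eq mult.commute)
  also have "\<dots> \<le> dissipation P \<eta> A D u w n"
    using \<kappa> e by (simp add: coercivity_const_def dissipation_def)
  finally show ?thesis
    by (simp add: rel_energy_def N)
qed

end


section \<open>Geometric decay\<close>

lemma geometric_decay:
  fixes E :: "nat \<Rightarrow> real"
  assumes "q \<ge> 0" "\<And>n. E (n + 1) \<le> q * E n"
  shows "E n \<le> q ^ n * E 0"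
proof (induction n)
  case (Suc n)
  have "E (Suc n) \<le> q * E n"
    using assms(2)[of n] by simp
  also have "\<dots> \<le> q * (q ^ n * E 0)"
    using Suc assms(1) by (rule mult_left_mono)
  finally show ?case
    by (simp add: mult.assoc)
qed simp

lemma geometric_decay_sqrt:
  fixes N :: "nat \<Rightarrow> real"
  assumes r: "r > 0" and N: "\<And>n. 0 \<le> N n" and step: "\<And>n. (N (n + 1))\<^sup>2 \<le> inverse r * (N n)\<^sup>2"
  shows "N n \<le> r powr (- (real n / 2)) * N 0"
proof -
  have "(N n)\<^sup>2 \<le> inverse r ^ n * (N 0)\<^sup>2"
    using r step by (intro geometric_decay) auto
  also have "inverse r ^ n = (r powr (- (real n / 2)))\<^sup>2"
    using r by (simp add: powr_power powr_minus powr_realpow power_inverse)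
  finally have "(N n)\<^sup>2 \<le> (r powr (- (real n / 2)) * N 0)\<^sup>2"
    by (simp add: power_mult_distrib)
  then show ?thesis
    by (rule power2_le_imp_le) (simp add: N)
qed

theorem theorem2:
  fixes P :: "'n::finite problem" and D :: "'n mesh"
    and A :: "real \<Rightarrow> real" and \<eta> \<Delta>t \<alpha> C\<^sub>P \<beta> \<kappa> \<nu> :: real
    and u :: "nat \<Rightarrow> 'n unknowns" and w :: "'n unknowns"
  assumes dim: "CARD('n) \<in> {2, 3}"
    and data: "is_data P"
    and mesh: "is_mesh P D"
    and eta: "\<eta> > 0"
    and adv: "is_adv_function A"
    and dt: "\<Delta>t > 0"
    and alpha: "grad_stability_const \<eta> D \<alpha>"
    and poincare: "poincare_const P D C\<^sub>P"
    and inflow: "AE x in surf. x \<in> GN P \<longrightarrow> normal_trace (region P) (adv_field P) x \<le> 0"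
    and beta: "\<beta> < 2 * lam_lo P * \<alpha> / C\<^sub>P\<^sup>2"
    and divergence: "AE x in lebesgue. x \<in> region P \<longrightarrow> weak_div (region P) (adv_field P) x \<ge> - \<beta>"
    and coercive: "coercivity_const P \<eta> A D \<kappa>"
    and evolution: "evolution_solution P \<eta> A D \<Delta>t u"
    and stationary: "stationary_solution P \<eta> A D w"
    and nu: "\<nu> = 2 * \<kappa> / C\<^sub>P\<^sup>2"
  shows "(\<forall>n. (rel_energy P D u w (n + 1) - rel_energy P D u w n) / \<Delta>t
             + dissipation P \<eta> A D u w (n + 1) \<le> 0)
       \<and> \<nu> > 0
       \<and> (\<forall>n. rel_energy P D u w (n + 1) \<le> inverse (1 + \<nu> * \<Delta>t) * rel_energy P D u w n)
       \<and> (\<forall>n\<ge>1. L2_norm_on lebesgue (region P) (\<lambda>x. cell_fun D (u n) x - cell_fun D w x)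
             \<le> (1 + \<nu> * \<Delta>t) powr (- (real n / 2))
               * L2_norm_on lebesgue (region P) (\<lambda>x. cell_fun D (u 0) x - cell_fun D w x))"
proof -
  let ?E = "rel_energy P D u w"
  let ?N = "\<lambda>n. L2_norm_on lebesgue (region P) (\<lambda>x. cell_fun D (u n) x - cell_fun D w x)"
  have "C\<^sub>P > 0" "\<kappa> > 0"
    using poincare coercive by (auto simp: poincare_const_def coercivity_const_def)
  then have nu_pos: "\<nu> > 0"
    by (simp add: nu)
  then have r: "1 + \<nu> * \<Delta>t > 0"
    using dt by (simp add: add_pos_pos)
  have diss: "(?E (n + 1) - ?E n) / \<Delta>t + dissipation P \<eta> A D u w (n + 1) \<le> 0" for n
    by (rule energy_dissipation[OF data mesh dt evolution stationary])
  have decay: "?E (n + 1) \<le> inverse (1 + \<nu> * \<Delta>t) * ?E n" for n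
  proof -
    have "u (n + 1) - w \<in> V0 P D"
      using evolution stationary
      by (intro V0_diff[OF data mesh]) (auto simp: evolution_solution_def stationary_solution_def)
    then have "\<nu> * ?E (n + 1) \<le> dissipation P \<eta> A D u w (n + 1)"
      unfolding nu by (rule rel_energy_le_dissipation[OF data mesh poincare coercive])
    then have "(?E (n + 1) - ?E n) / \<Delta>t + \<nu> * ?E (n + 1) \<le> 0"
      using diss[of n] by linarith
    then have "(1 + \<nu> * \<Delta>t) * ?E (n + 1) \<le> ?E n"
      using dt by (simp add: field_simps)
    then show ?thesis
      using r by (simp add: field_simps)
  qed
  have "?N n \<le> (1 + \<nu> * \<Delta>t) powr (- (real n / 2)) * ?N 0" for n
  proof (rule geometric_decay_sqrt[OF r, where N = ?N])
    show "0 \<le> ?N n" for n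
      unfolding L2_norm_on_def set_lebesgue_integral_def
      by (intro real_sqrt_ge_zero Bochner_Integration.integral_nonneg) simp
    show "(?N (n + 1))\<^sup>2 \<le> inverse (1 + \<nu> * \<Delta>t) * (?N n)\<^sup>2" for n
      using decay[of n] by (simp add: rel_energy_def)
  qed
  with diss nu_pos decay show ?thesis
    by blast
qed

end
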